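(* Let $A_n$, $f_n$ and $F_n$ be as defined in the context. Then \[ \lim_{n\to\infty}\frac{\log|A_n|}{f_n} = \lim_{n\to\infty}\frac{\log|F_n|}{f_n}. \]
   Context: Words are finite sequences over the alphabet $\{0,1\}$; $uv$ denotes concatenation, and for sets of words $UV=\{uv: u\in U, v\in V\}$. Define sets of words $A_1=\{0\}$, $A_2=\{1\}$ and, for $n\ge 3$, $A_n = A_{n-1}A_{n-2}\cup A_{n-2}A_{n-1}$. All words in $A_n$ have the same length, denoted $f_n$; it satisfies $f_1=f_2=1$, $f_n=f_{n-1}+f_{n-2}$ (Fibonacci numbers). A word $x$ is a factor of a word $w$ if $w=uxv$ for some (possibly empty) words $u,v$. Let $F_n$ denote the set of all factors of length $f_n$ of words lying in $\bigcup_{m\ge 1} A_m$ (the factors of length $f_n$ of the random Fibonacci words). $|\cdot|$ denotes cardinality of a set. *)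

theory Defs
  imports Complex_Main "HOL-Library.Sublist" "HOL-Number_Theory.Fib"
begin

text \<open>The alphabet is \<^typ>\<open>bool\<close>, with \<^term>\<open>False\<close> standing for the letter 0 and
  \<^term>\<open>True\<close> for the letter 1.\<close>

type_synonym word = "bool list"

definition conc :: "word set \<Rightarrow> word set \<Rightarrow> word set" where
  "conc U V = {u @ v | u v. u \<in> U \<and> v \<in> V}"

text \<open>The sequence starts at index 1; the value at index 0 is a dummy.\<close>

fun A :: "nat \<Rightarrow> word set" where
  "A 0 = {}"
| "A (Suc 0) = {[False]}"
| "A (Suc (Suc 0)) = {[True]}"
| "A (Suc (Suc (Suc n))) =
     conc (A (Suc (Suc n))) (A (Suc n)) \<union> conc (A (Suc n)) (A (Suc (Suc n)))"

text \<open>The common length of the words in \<^term>\<open>A n\<close> is the library's Fibonacci number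
  \<^term>\<open>fib n\<close>.\<close>

lemma length_A: "w \<in> A n \<Longrightarrow> length w = fib n"
  by (induction n arbitrary: w rule: A.induct) (auto simp: conc_def)

lemma A_nonempty: "n \<ge> 1 \<Longrightarrow> A n \<noteq> {}"
  by (induction n rule: A.induct) (auto simp: conc_def)

definition F :: "nat \<Rightarrow> word set" where
  "F n = {x. length x = fib n \<and> (\<exists>m\<ge>1. \<exists>w\<in>A m. sublist x w)}"

end

theory Submission imports Defs begin

text \<open>Since \<open>|A n|\<close> lies between \<open>|A (n-1)| |A (n-2)|\<close> and twice that product, the sequence
  \<open>ln |A n|\<close> satisfies the Fibonacci recurrence up to a bounded error, so \<open>ln |A n| / fib n\<close>
  has summable increments and converges to some \<open>L\<close>. Clearly \<open>A n \<subseteq> F n\<close>. Conversely fix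
  \<open>d > L\<close>. For \<open>k\<close> large, \<open>W = A k \<union> A (k+1)\<close> satisfies the Kraft-type inequality
  \<open>\<Sum>w\<in>W. exp (- d |w|) \<le> 1\<close>, and every word in \<open>A m\<close> with \<open>m \<ge> k\<close> is a concatenation of
  words in \<open>W\<close>. Peeling off blocks one at a time, the Kraft inequality shows that such
  concatenations have only \<open>O(exp (d N))\<close> factors of length \<open>N\<close>.\<close>

section \<open>Counting factors of concatenations\<close>

lemma finite_words_length_le: "finite {s :: 'a::finite list. length s \<le> l}"
  using finite_lists_length_le[of "UNIV :: 'a set" l] by simp

lemma finite_words_length_eq: "finite {s :: 'a::finite list. length s = l}"
  by (rule finite_subset[OF _ finite_words_length_le[of l]]) auto

lemma card_UN_append_le:
  assumes "finite S" "\<And>s. s \<in> S \<Longrightarrow> finite (Q s)"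
  shows "card (\<Union>s\<in>S. (@) s ` Q s) \<le> (\<Sum>s\<in>S. card (Q s))"
  by (rule order.trans[OF card_UN_le]) (auto intro!: sum_mono card_image_le simp: assms)

text \<open>A prefix longer than every block swallows its first block \<open>w\<close> whole and
  leaves a prefix of length \<open>N - length w\<close>. The union bound needs no unique decoding,
  and the Kraft sum absorbs the factors \<open>exp (- d * length w)\<close>.\<close>

lemma card_prefixes_star_le:
  fixes W :: "'a::finite list set" and d :: real
  assumes fin: "finite W" and ne: "[] \<notin> W" and len: "\<And>w. w \<in> W \<Longrightarrow> length w \<le> l"
    and kraft: "(\<Sum>w\<in>W. exp (- d * length w)) \<le> 1" and d: "d \<ge> 0"
  shows "real (card {x. length x = N \<and> (\<exists>ws\<in>lists W. prefix x (concat ws))})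
           \<le> card {s :: 'a list. length s \<le> l} * exp (d * N)"
proof (induction N rule: less_induct)
  case (less N)
  define P where "P = (\<lambda>N. {x. length x = N \<and> (\<exists>ws\<in>lists W. prefix x (concat ws))})"
  define C where "C = real (card {s :: 'a list. length s \<le> l})"
  have finP: "finite (P M)" for M
    by (rule finite_subset[OF _ finite_words_length_eq[of M]]) (auto simp: P_def)
  have C0: "C \<ge> 0" by (simp add: C_def)
  have "real (card (P N)) \<le> C * exp (d * N)"
  \<comment> \<open>For \<open>N \<le> l\<close> the constant, which counts all words of length at
    most \<open>l\<close>, suffices; otherwise \<open>N\<close> exceeds every block length.\<close>
  proof (cases "N \<le> l")
    case True
    then have "card (P N) \<le> card {s :: 'a list. length s \<le> l}"
      by (intro card_mono finite_words_length_le) (auto simp: P_def)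
    then have "real (card (P N)) \<le> C * 1" by (simp add: C_def)
    also have "\<dots> \<le> C * exp (d * N)" using C0 d by (intro mult_left_mono) auto
    finally show ?thesis .
  next
    case False
    have sub: "P N \<subseteq> (\<Union>w\<in>W. (@) w ` P (N - length w))"
    proof
      fix x assume "x \<in> P N"
      then obtain ws where ws: "ws \<in> lists W" "prefix x (concat ws)" "length x = N"
        by (auto simp: P_def)
      from ws False obtain w vs where wv: "ws = w # vs" by (cases ws) auto
      with ws have w: "w \<in> W" "vs \<in> lists W" by auto
      have "\<not> prefix x w" using len[OF w(1)] False ws(3) prefix_length_le by fastforce
      with ws(2) wv obtain y where y: "x = w @ y" "prefix y (concat vs)"
        by (auto simp: prefix_append)
      with w ws(3) have "y \<in> P (N - length w)" by (auto simp: P_def)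
      with y w show "x \<in> (\<Union>w\<in>W. (@) w ` P (N - length w))" by blast
    qed
    have "card (P N) \<le> card (\<Union>w\<in>W. (@) w ` P (N - length w))"
      by (intro card_mono sub) (simp add: fin finP)
    also have "\<dots> \<le> (\<Sum>w\<in>W. card (P (N - length w)))"
      by (intro card_UN_append_le fin finP)
    finally have "real (card (P N)) \<le> real (\<Sum>w\<in>W. card (P (N - length w)))"
      by (rule of_nat_mono)
    also have "\<dots> = (\<Sum>w\<in>W. real (card (P (N - length w))))" by (rule of_nat_sum)
    also have "\<dots> \<le> (\<Sum>w\<in>W. C * exp (d * N) * exp (- d * length w))"
    proof (intro sum_mono)
      fix w assume w: "w \<in> W"
      \<comment> \<open>Nonempty blocks make \<open>N\<close> decrease strictly;
        \<open>length w \<le> N\<close> makes the truncated subtraction exact.\<close>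
      with ne have "length w > 0" by auto
      moreover have "length w \<le> N" using len[OF w] False by simp
      ultimately have "N - length w < N" by linarith
      then have "real (card (P (N - length w))) \<le> C * exp (d * (N - length w))"
        unfolding P_def C_def by (rule less)
      also have "exp (d * (N - length w)) = exp (d * N) * exp (- d * length w)"
        using \<open>length w \<le> N\<close> by (simp add: mult_exp_exp of_nat_diff algebra_simps)
      finally show "real (card (P (N - length w))) \<le> C * exp (d * N) * exp (- d * length w)"
        by (simp add: mult.assoc)
    qed
    also have "\<dots> = C * exp (d * N) * (\<Sum>w\<in>W. exp (- d * length w))"
      by (simp add: sum_distrib_left)
    also have "\<dots> \<le> C * exp (d * N) * 1"
      using C0 by (intro mult_left_mono kraft) auto
    finally show ?thesis by simp
  qed
  then show ?case by (simp add: P_def C_def)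
qed

text \<open>A factor may start inside a block: it takes a short suffix \<open>s\<close> of that
  block and continues as a prefix of the following blocks. A factor lying within one block is itself
  the short piece.\<close>

lemma sublist_concat_split:
  assumes "ws \<in> lists W" "sublist x (concat ws)" and len: "\<And>w. w \<in> W \<Longrightarrow> length w \<le> l"
  shows "\<exists>s p vs. x = s @ p \<and> length s \<le> l \<and> vs \<in> lists W \<and> prefix p (concat vs)"
  using assms(1,2)
proof (induction ws)
  case Nil
  then show ?case by (intro exI[of _ "[]"]) auto
next
  case (Cons w ws)
  from Cons.prems consider "sublist x w" | "sublist x (concat ws)"
    | s p where "x = s @ p" "suffix s w" "prefix p (concat ws)"
    by (auto simp: sublist_append)
  then show ?case
  proof cases
    case 1
    then have "length x \<le> l" using len[OF Cons.hyps(1)] sublist_length_le by fastforce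
    then show ?thesis by (intro exI[of _ x] exI[of _ "[]"]) auto
  next
    case 2
    then show ?thesis by (rule Cons.IH)
  next
    case 3
    then have "length s \<le> l" using len[OF Cons.hyps(1)] suffix_length_le by fastforce
    then show ?thesis using 3 Cons.hyps by blast
  qed
qed

text \<open>There are finitely many short starts \<open>s\<close>, independently of
  \<open>N\<close>, and each continues as a prefix of a concatenation; hence the constant
  \<open>C * C\<close>.\<close>

lemma card_factors_star_le:
  fixes W :: "'a::finite list set" and d :: real
  assumes fin: "finite W" and ne: "[] \<notin> W"
    and kraft: "(\<Sum>w\<in>W. exp (- d * length w)) \<le> 1" and d: "d \<ge> 0"
  shows "\<exists>C. \<forall>N. real (card {x. length x = N \<and> (\<exists>ws\<in>lists W. sublist x (concat ws))})
           \<le> C * exp (d * N)"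
proof -
  obtain l where len: "\<And>w. w \<in> W \<Longrightarrow> length w \<le> l"
    using finite_nat_set_iff_bounded_le[of "length ` W"] fin by auto
  define S where "S = {s :: 'a list. length s \<le> l}"
  define P where "P = (\<lambda>N. {x. length x = N \<and> (\<exists>ws\<in>lists W. prefix x (concat ws))})"
  define C where "C = real (card S)"
  have finS: "finite S" unfolding S_def by (rule finite_words_length_le)
  have finP: "finite (P M)" for M
    by (rule finite_subset[OF _ finite_words_length_eq[of M]]) (auto simp: P_def)
  have P_le: "real (card (P M)) \<le> C * exp (d * M)" for M
    using card_prefixes_star_le[OF fin ne len kraft d] by (simp add: P_def C_def S_def)
  have "real (card {x. length x = N \<and> (\<exists>ws\<in>lists W. sublist x (concat ws))})
          \<le> C * C * exp (d * N)" for N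
  proof -
    have sub: "{x. length x = N \<and> (\<exists>ws\<in>lists W. sublist x (concat ws))}
            \<subseteq> (\<Union>s\<in>S. (@) s ` P (N - length s))" (is "?X \<subseteq> ?Y")
    proof
      fix x assume "x \<in> ?X"
      then obtain ws where "ws \<in> lists W" "sublist x (concat ws)" and N: "length x = N" by auto
      from sublist_concat_split[OF this(1,2) len] obtain s p vs
        where *: "x = s @ p" "length s \<le> l" "vs \<in> lists W" "prefix p (concat vs)" by blast
      then have "p \<in> P (N - length s)" "s \<in> S" using N by (auto simp: P_def S_def)
      with * show "x \<in> ?Y" by blast
    qed
    have "card ?X \<le> card ?Y"
      by (intro card_mono sub) (simp add: finS finP)
    also have "\<dots> \<le> (\<Sum>s\<in>S. card (P (N - length s)))"
      by (intro card_UN_append_le finS finP)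
    finally have "real (card ?X) \<le> real (\<Sum>s\<in>S. card (P (N - length s)))"
      by (rule of_nat_mono)
    also have "\<dots> = (\<Sum>s\<in>S. real (card (P (N - length s))))" by (rule of_nat_sum)
    also have "\<dots> \<le> (\<Sum>s\<in>S. C * exp (d * N))"
    proof (intro sum_mono)
      fix s
      have "C * exp (d * (N - length s)) \<le> C * exp (d * N)"
        using d by (intro mult_left_mono) (auto simp: C_def intro!: mult_left_mono)
      with P_le[of "N - length s"]
      show "real (card (P (N - length s))) \<le> C * exp (d * N)" by linarith
    qed
    also have "\<dots> = C * C * exp (d * N)" by (simp add: C_def)
    finally show ?thesis .
  qed
  then show ?thesis by blast
qed

section \<open>Almost-Fibonacci recurrences\<close>

text \<open>From index 2 on, consecutive Fibonacci numbers grow by a factor of at least 3/2.\<close>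

lemma summable_inverse_fib: "summable (\<lambda>n. 1 / real (fib n))"
proof (rule summable_ratio_test[of "2/3" 2])
  fix n :: nat assume "n \<ge> 2"
  then obtain m where m: "n = Suc (Suc m)" by (metis Suc_le_D numeral_2_eq_2 Suc_le_mono)
  have "fib m \<le> fib (Suc m)" by (rule fib_mono) simp
  then have "3 * fib n \<le> 2 * fib (Suc n)" by (simp add: m)
  then have "3 * real (fib n) \<le> 2 * real (fib (Suc n))" by linarith
  moreover have "fib n > 0" "fib (Suc n) > 0" using \<open>n \<ge> 2\<close> by (auto intro!: fib_neq_0_nat)
  ultimately show "norm (1 / real (fib (Suc n))) \<le> 2 / 3 * norm (1 / real (fib n))"
    by (simp add: field_simps)
qed simp

lemma convergent_almost_fibonacci:
  fixes b :: "nat \<Rightarrow> real"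
  assumes rec: "\<And>n. \<bar>b (n + 3) - b (n + 2) - b (n + 1)\<bar> \<le> c"
  shows "convergent (\<lambda>n. b n / fib n)"
proof -
  \<comment> \<open>The determinant of \<open>b\<close> against \<open>fib\<close>, the numerator of
    the increments of \<open>b n / fib n\<close>. An exact Fibonacci recurrence would only flip its
    sign; the error adds at most \<open>c * fib (n + 2)\<close> per step.\<close>
  define D where "D n = b (n + 2) * fib (n + 1) - b (n + 1) * fib (n + 2)" for n
  \<comment> \<open>\<open>c\<close> serves the induction step below, \<open>\<bar>D 0\<bar>\<close>
    its base case.\<close>
  define K where "K = max c \<bar>D 0\<bar>"
  have D_Suc: "D (Suc n) = (b (n + 3) - b (n + 2) - b (n + 1)) * fib (n + 2) - D n" for n
    by (simp add: D_def eval_nat_numeral algebra_simps)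
  have D_le: "\<bar>D n\<bar> \<le> K * fib (n + 3)" for n
  proof (induction n)
    case 0
    show ?case by (simp add: K_def eval_nat_numeral)
  next
    case (Suc n)
    have "\<bar>D (Suc n)\<bar> \<le> \<bar>b (n + 3) - b (n + 2) - b (n + 1)\<bar> * fib (n + 2) + \<bar>D n\<bar>"
      unfolding D_Suc by (rule order.trans[OF abs_triangle_ineq4]) (simp add: abs_mult)
    also have "\<dots> \<le> K * fib (n + 2) + K * fib (n + 3)"
      using rec[of n] Suc.IH by (intro add_mono mult_right_mono) (auto simp: K_def)
    also have "\<dots> = K * fib (Suc n + 3)"
      by (simp add: eval_nat_numeral algebra_simps)
    finally show ?case .
  qed
  \<comment> \<open>The shift avoids the denominator \<open>fib 0 = 0\<close>.\<close>
  define s where "s n = b (n + 1) / fib (n + 1)" for n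
  have "summable (\<lambda>n. s (Suc n) - s n)"
  proof (rule summable_comparison_test')
    show "summable (\<lambda>n. 2 * K * (1 / real (fib (n + 1))))"
      using summable_ignore_initial_segment[OF summable_inverse_fib, of 1]
      by (rule summable_mult)
  next
    fix n :: nat
    have pos: "fib (n + 1) > 0" "fib (n + 2) > 0" by (auto intro!: fib_neq_0_nat)
    have "K \<ge> 0" by (simp add: K_def)
    have "s (Suc n) - s n = D n / (fib (n + 1) * fib (n + 2))"
      using pos by (simp add: s_def D_def field_simps del: fib.simps)
    then have "norm (s (Suc n) - s n) = \<bar>D n\<bar> / (fib (n + 1) * fib (n + 2))"
      by (simp add: abs_mult)
    \<comment> \<open>Bounding \<open>fib (n + 3)\<close> by \<open>2 * fib (n + 2)\<close> cancels
      one denominator and leaves a summable term.\<close>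
    also have "\<dots> \<le> K * (2 * fib (n + 2)) / (fib (n + 1) * fib (n + 2))"
    proof (intro divide_right_mono)
      have "fib (n + 1) \<le> fib (n + 2)" by (rule fib_mono) simp
      then have "fib (n + 3) \<le> 2 * fib (n + 2)" by (simp add: eval_nat_numeral)
      then have "real (fib (n + 3)) \<le> 2 * fib (n + 2)" by linarith
      then have "K * fib (n + 3) \<le> K * (2 * fib (n + 2))"
        using \<open>K \<ge> 0\<close> by (intro mult_left_mono)
      with D_le[of n] show "\<bar>D n\<bar> \<le> K * (2 * fib (n + 2))" by linarith
    qed simp
    also have "\<dots> = 2 * K * (1 / real (fib (n + 1)))"
      using pos by (simp add: field_simps del: fib.simps)
    finally show "norm (s (Suc n) - s n) \<le> 2 * K * (1 / real (fib (n + 1)))" .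
  qed
  then have "convergent (\<lambda>n. \<Sum>i<n. s (Suc i) - s i)"
    by (simp add: summable_iff_convergent)
  then have "convergent (\<lambda>n. s n - s 0)"
    by (simp add: sum_lessThan_telescope)
  then have "convergent s"
    using convergent_add[OF _ convergent_const[of "s 0"], of "\<lambda>n. s n - s 0"] by simp
  then show ?thesis
    unfolding s_def using convergent_Suc_iff[of "\<lambda>n. b n / fib n"] by simp
qed

section \<open>Random Fibonacci words\<close>

lemma A_rec: "A (n + 3) = conc (A (n + 2)) (A (n + 1)) \<union> conc (A (n + 1)) (A (n + 2))"
  by (simp add: eval_nat_numeral)

lemma finite_A: "finite (A n)"
  by (rule finite_subset[OF _ finite_words_length_eq[of "fib n"]]) (auto dest: length_A)

lemma card_A_pos: "n > 0 \<Longrightarrow> card (A n) > 0"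
  using A_nonempty[of n] finite_A[of n] by (simp add: card_gt_0_iff)

text \<open>Words in \<open>A m\<close> share one length, so a concatenation determines where it
  splits.\<close>

lemma card_conc_A: "card (conc (A m) (A n)) = card (A m) * card (A n)"
proof -
  have "conc (A m) (A n) = (\<lambda>(u, v). u @ v) ` (A m \<times> A n)"
    by (auto simp: conc_def)
  moreover have "inj_on (\<lambda>(u, v). u @ v) (A m \<times> A n)"
    by (auto simp: inj_on_def dest!: length_A)
  ultimately show ?thesis by (simp add: card_image card_cartesian_product)
qed

text \<open>The two halves of the union have equal size \<open>p\<close>; their unknown overlap
  leaves only a factor between 1 and 2.\<close>

lemma ln_card_A_rec:
  "\<bar>ln (card (A (n + 3))) - ln (card (A (n + 2))) - ln (card (A (n + 1)))\<bar> \<le> ln 2"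
proof -
  define p where "p = card (A (n + 2)) * card (A (n + 1))"
  have pos: "card (A (n + 2)) > 0" "card (A (n + 1)) > 0" "card (A (n + 3)) > 0"
    by (auto intro: card_A_pos)
  then have p: "p > 0" "ln p = ln (card (A (n + 2))) + ln (card (A (n + 1)))"
    by (auto simp: p_def ln_mult)
  have "conc (A (n + 2)) (A (n + 1)) \<subseteq> A (n + 3)" unfolding A_rec by blast
  then have "p \<le> card (A (n + 3))"
    using card_mono[OF finite_A] by (simp add: p_def flip: card_conc_A)
  then have "ln p \<le> ln (card (A (n + 3)))" using p(1) by simp
  moreover have "card (A (n + 3)) \<le> 2 * p"
    using card_Un_le[of "conc (A (n + 2)) (A (n + 1))" "conc (A (n + 1)) (A (n + 2))"]
    unfolding A_rec card_conc_A p_def by (metis mult.commute mult_2)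
  then have "ln (card (A (n + 3))) \<le> ln (2 * p)"
    using pos(3) by (subst ln_le_cancel_iff) auto
  then have "ln (card (A (n + 3))) \<le> ln 2 + ln p" using p(1) by (simp add: ln_mult)
  ultimately show ?thesis using p(2) by linarith
qed

text \<open>The recursion reaches back two levels, so unfolding it can stop at two consecutive
  levels.\<close>

lemma A_subset_star:
  assumes "m \<ge> k" "k > 0"
  shows "A m \<subseteq> concat ` lists (A k \<union> A (Suc k))"
  using assms(1)
proof (induction m rule: less_induct)
  case (less m)
  let ?W = "A k \<union> A (Suc k)"
  have conc_star: "conc U V \<subseteq> concat ` lists ?W"
    if "U \<subseteq> concat ` lists ?W" "V \<subseteq> concat ` lists ?W" for U V
  proof
    fix x assume "x \<in> conc U V"
    with that obtain us vs where "us \<in> lists ?W" "vs \<in> lists ?W" "x = concat us @ concat vs"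
      unfolding conc_def by blast
    then show "x \<in> concat ` lists ?W" by (intro image_eqI[of _ _ "us @ vs"]) auto
  qed
  show ?case
  proof (cases "m \<le> Suc k")
    case True
    with less.prems have "A m \<subseteq> ?W" by (auto simp: le_Suc_eq)
    moreover have "x \<in> concat ` lists ?W" if "x \<in> ?W" for x
      using that by (intro image_eqI[of _ _ "[x]"]) auto
    ultimately show ?thesis by blast
  next
    case False
    \<comment> \<open>\<open>m > Suc k\<close> and \<open>k > 0\<close> give
      \<open>m \<ge> 3\<close>, so nothing is truncated.\<close>
    define j where "j = m - 3"
    have m: "m = j + 3" "k \<le> j + 1" using False assms(2) by (auto simp: j_def)
    have "A (j + 2) \<subseteq> concat ` lists ?W" "A (j + 1) \<subseteq> concat ` lists ?W"
      using m by (intro less.IH; simp)+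
    then show ?thesis unfolding m A_rec by (intro Un_least conc_star)
  qed
qed

section \<open>Bounds for \<open>card (F n)\<close>\<close>

lemma finite_F: "finite (F n)"
  by (rule finite_subset[OF _ finite_words_length_eq[of "fib n"]]) (auto simp: F_def)

lemma A_subset_F: "n > 0 \<Longrightarrow> A n \<subseteq> F n"
  by (auto simp: F_def length_A intro!: exI[of _ n])

text \<open>Levels below \<open>k\<close> do not decompose into these blocks, but their words are
  too short to have a factor of length \<open>fib n\<close>. The gap of 2 gives the strict
  inequality \<open>fib k < fib (k + 2)\<close>, whereas \<open>fib 1 = fib 2\<close>.\<close>

lemma F_subset_factors_star:
  assumes "k > 0" "n \<ge> k + 2"
  shows "F n \<subseteq> {x. length x = fib n \<and> (\<exists>ws\<in>lists (A k \<union> A (Suc k)). sublist x (concat ws))}"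
proof
  fix x assume "x \<in> F n"
  then obtain m w where x: "length x = fib n" "w \<in> A m" "sublist x w" by (auto simp: F_def)
  have "k \<le> m"
  proof (rule ccontr)
    assume "\<not> k \<le> m"
    then have "fib m \<le> fib k" by (intro fib_mono) simp
    also have "fib k < fib (k + 2)" by (simp add: fib_neq_0_nat)
    also have "\<dots> \<le> fib n" using assms by (intro fib_mono)
    finally show False using sublist_length_le[OF x(3)] x(1) length_A[OF x(2)] by simp
  qed
  then have "w \<in> concat ` lists (A k \<union> A (Suc k))" using A_subset_star assms(1) x(2) by blast
  with x show "x \<in> {x. length x = fib n \<and> (\<exists>ws\<in>lists (A k \<union> A (Suc k)). sublist x (concat ws))}"
    by blast
qed

text \<open>All terms equal \<open>exp (- d * fib n)\<close>, so the sum is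
  \<open>exp (ln (card (A n)) - d * fib n)\<close>. The slack \<open>ln 2 / fib n\<close> buys the
  factor 1/2, letting two levels together stay below 1.\<close>

lemma kraft_A_le_half:
  fixes d :: real
  assumes "n > 0" "ln (card (A n)) / fib n + ln 2 / fib n \<le> d"
  shows "(\<Sum>w\<in>A n. exp (- d * length w)) \<le> 1 / 2"
proof -
  have pos: "real (fib n) > 0" "real (card (A n)) > 0"
    using assms(1) by (simp_all add: fib_neq_0_nat card_A_pos)
  have "(\<Sum>w\<in>A n. exp (- d * length w)) = (\<Sum>w\<in>A n. exp (- d * fib n))"
    by (intro sum.cong) (auto dest: length_A)
  also have "\<dots> = exp (ln (card (A n)) - d * fib n)"
    using pos by (simp add: exp_diff exp_minus field_simps)
  also have "\<dots> \<le> exp (- ln 2)"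
    using assms(2) pos by (simp add: field_simps)
  also have "\<dots> = 1 / 2" by (simp add: exp_minus field_simps)
  finally show ?thesis .
qed

text \<open>The Kraft condition at the two levels \<open>k\<close> and \<open>Suc k\<close> controls
  all later \<open>n\<close>. \<open>C\<close> does not depend on \<open>n\<close>, so it vanishes
  after division by \<open>fib n\<close>.\<close>

lemma ln_card_F_le:
  fixes d :: real
  assumes "k > 0" "d \<ge> 0"
    and "\<And>n. n \<in> {k, Suc k} \<Longrightarrow> ln (card (A n)) / fib n + ln 2 / fib n \<le> d"
  shows "\<exists>C::real. \<forall>n\<ge>k+2. ln (card (F n)) \<le> C + d * fib n"
proof -
  let ?W = "A k \<union> A (Suc k)"
  have "(\<Sum>w\<in>?W. exp (- d * length w))
      \<le> (\<Sum>w\<in>A k. exp (- d * length w)) + (\<Sum>w\<in>A (Suc k). exp (- d * length w))"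
    using sum.union_inter[OF finite_A finite_A, of "\<lambda>w. exp (- d * length w)" k "Suc k"]
      sum_nonneg[of "A k \<inter> A (Suc k)" "\<lambda>w. exp (- d * length w)"] by simp
  also have "\<dots> \<le> 1 / 2 + 1 / 2"
    using assms by (intro add_mono kraft_A_le_half) auto
  finally have kraft: "(\<Sum>w\<in>?W. exp (- d * length w)) \<le> 1" by simp
  have ne: "[] \<notin> ?W" using assms(1) fib_neq_0_nat[of k] fib_neq_0_nat[of "Suc k"] by (auto dest!: length_A)
  obtain C where C: "\<And>N. real (card {x. length x = N \<and> (\<exists>ws\<in>lists ?W. sublist x (concat ws))})
                      \<le> C * exp (d * N)"
    using card_factors_star_le[OF _ ne kraft assms(2)] finite_A by blast
  have "ln (card (F n)) \<le> ln C + d * fib n" if n: "n \<ge> k + 2" for n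
  proof -
    let ?X = "{x. length x = fib n \<and> (\<exists>ws\<in>lists ?W. sublist x (concat ws))}"
    have "finite ?X" by (rule finite_subset[OF _ finite_words_length_eq[of "fib n"]]) auto
    then have "card (F n) \<le> card ?X"
      using F_subset_factors_star[OF assms(1) n] by (rule card_mono)
    then have le: "real (card (F n)) \<le> C * exp (d * fib n)" using C[of "fib n"] by linarith
    \<comment> \<open>Nonemptiness of \<open>F n\<close> makes both \<open>card (F n)\<close> and
      \<open>C\<close> positive, as the logarithms require.\<close>
    have "card (A n) \<le> card (F n)" using n by (intro card_mono finite_F A_subset_F) auto
    then have pos: "real (card (F n)) > 0" using card_A_pos[of n] n by simp
    with le have "0 < C * exp (d * fib n)" by linarith
    then have "C > 0" by (simp add: zero_less_mult_iff)
    have "ln (card (F n)) \<le> ln (C * exp (d * fib n))"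
      using pos le by simp
    also have "\<dots> = ln C + d * fib n" using \<open>C > 0\<close> by (simp add: ln_mult)
    finally show ?thesis .
  qed
  then show ?thesis by blast
qed

theorem theorem1:
  "\<exists>L::real. (\<lambda>n. ln (real (card (A n))) / real (fib n)) \<longlonglongrightarrow> L \<and>
             (\<lambda>n. ln (real (card (F n))) / real (fib n)) \<longlonglongrightarrow> L"
proof -
  define s where "s n = ln (real (card (A n))) / real (fib n)" for n
  define t where "t n = ln (real (card (F n))) / real (fib n)" for n
  have "convergent s"
    unfolding s_def using ln_card_A_rec by (rule convergent_almost_fibonacci)
  then obtain L where L: "s \<longlonglongrightarrow> L" by (auto simp: convergent_def)
  \<comment> \<open>At \<open>n = 0\<close> the quotient is 0, as division by
    \<open>fib 0 = 0\<close> yields 0.\<close>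
  have s0: "s n \<ge> 0" for n
    using card_A_pos[of n] by (cases "n = 0") (auto simp: s_def intro!: divide_nonneg_nonneg)
  have "L \<ge> 0" using L s0 by (intro LIMSEQ_le_const) auto
  have inv_fib: "(\<lambda>n. 1 / real (fib n)) \<longlonglongrightarrow> 0"
    using summable_inverse_fib by (rule summable_LIMSEQ_zero)
  have s_le_t: "s n \<le> t n" if "n > 0" for n
  proof -
    have "card (A n) \<le> card (F n)" using that by (intro card_mono finite_F A_subset_F)
    then have "ln (card (A n)) \<le> ln (card (F n))" using card_A_pos[OF that] by simp
    then show ?thesis unfolding s_def t_def by (rule divide_right_mono) simp
  qed
  have "t \<longlonglongrightarrow> L"
  proof (rule order_tendstoI)
    fix a assume "a < L"
    with L have "eventually (\<lambda>n. a < s n) sequentially" by (rule order_tendstoD)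
    then show "eventually (\<lambda>n. a < t n) sequentially"
      using eventually_gt_at_top[of 0]
    proof eventually_elim
      case (elim n)
      with s_le_t[of n] show ?case by simp
    qed
  next
    fix a assume "L < a"
    then obtain d where d: "L < d" "d < a" using dense by blast
    \<comment> \<open>The Kraft slack tends to 0, so every exponent \<open>d > L\<close> is
      admissible at all large levels.\<close>
    have "(\<lambda>n. s n + ln 2 * (1 / real (fib n))) \<longlonglongrightarrow> L + ln 2 * 0"
      by (intro tendsto_intros L inv_fib)
    then have "eventually (\<lambda>n. s n + ln 2 * (1 / real (fib n)) < d) sequentially"
      using d(1) by (intro order_tendstoD) auto
    then obtain k0 where k0: "\<And>n. n \<ge> k0 \<Longrightarrow> s n + ln 2 * (1 / real (fib n)) < d"
      by (auto simp: eventually_sequentially)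
    \<comment> \<open>The successor ensures \<open>k > 0\<close>.\<close>
    define k where "k = Suc k0"
    have "\<exists>C::real. \<forall>n\<ge>k+2. ln (card (F n)) \<le> C + d * fib n"
    proof (rule ln_card_F_le)
      fix n assume "n \<in> {k, Suc k}"
      then show "ln (card (A n)) / fib n + ln 2 / fib n \<le> d"
        using k0[of n] by (auto simp: k_def s_def)
    qed (use d \<open>L \<ge> 0\<close> in \<open>auto simp: k_def\<close>)
    then obtain C where C: "\<And>n. n \<ge> k + 2 \<Longrightarrow> ln (card (F n)) \<le> C + d * fib n" by blast
    have "(\<lambda>n. C * (1 / real (fib n)) + d) \<longlonglongrightarrow> C * 0 + d"
      by (intro tendsto_intros inv_fib)
    then have "eventually (\<lambda>n. C * (1 / real (fib n)) + d < a) sequentially"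
      using d(2) by (intro order_tendstoD) auto
    then show "eventually (\<lambda>n. t n < a) sequentially"
      using eventually_ge_at_top[of "k + 2"]
    proof eventually_elim
      case (elim n)
      have "fib n > 0" using elim(2) by (intro fib_neq_0_nat) simp
      then have "t n \<le> C * (1 / real (fib n)) + d"
        using C[OF elim(2)] by (simp add: t_def field_simps)
      with elim(1) show ?case by simp
    qed
  qed
  with L show ?thesis unfolding s_def t_def by blast
qed

end
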